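(* Let $G$ be a finite simple bipartite graph without isolated vertices that is false twin-free. Then $\gamma_t(G)=\gamma_{gr}^t(G)=4$ if and only if there is an integer $n\ge 2$ such that $G$ is isomorphic to the graph $K_{n,n}-M$ obtained from the complete bipartite graph $K_{n,n}$ by deleting the edges of a perfect matching $M$ of $K_{n,n}$.
   Context: For a vertex $v$ of a graph $G$, $N(v)$ denotes the open neighborhood (set of neighbors) of $v$. Two distinct vertices $u,v$ are false twins if $N(u)=N(v)$; a graph is false twin-free if it has no false twins. Let $G$ be a graph without isolated vertices. A set $S\subseteq V(G)$ is a total dominating set if every vertex of $G$ has a neighbor in $S$; the total domination number $\gamma_t(G)$ is the minimum cardinality of a total dominating set. A sequence $(v_1,\dots,v_k)$ of distinct vertices of $G$ is legal if $N(v_i)\setminus\bigcup_{j<i}N(v_j)\neq\emptyset$ for every $i\in\{2,\dots,k\}$. A legal sequence whose underlying set $\{v_1,\dots,v_k\}$ is a total dominating set is a total dominating sequence. The Grundy total domination number $\gamma_{gr}^t(G)$ is the maximum length of a total dominating sequence of $G$. *)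

theory Defs
  imports "Graph_Theory.Kuratowski" "Graph_Theory.Digraph_Isomorphism"
begin

text \<open>
  A finite simple graph is a \<^locale>\<open>pair_graph\<close>: a finite vertex set with a finite, symmetric,
  loop-free set of arcs, an undirected edge \<open>{u, v}\<close> being given by the two arcs
  \<open>(u, v)\<close> and \<open>(v, u)\<close>.
\<close>

definition neighborhood :: "'a pair_pre_digraph \<Rightarrow> 'a \<Rightarrow> 'a set" where
  "neighborhood G v = {u. (v, u) \<in> parcs G}"

definition no_isolated_vertices :: "'a pair_pre_digraph \<Rightarrow> bool" where
  "no_isolated_vertices G \<longleftrightarrow> (\<forall>v \<in> pverts G. neighborhood G v \<noteq> {})"

definition false_twins :: "'a pair_pre_digraph \<Rightarrow> 'a \<Rightarrow> 'a \<Rightarrow> bool" where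
  "false_twins G u v \<longleftrightarrow>
     u \<in> pverts G \<and> v \<in> pverts G \<and> u \<noteq> v \<and> neighborhood G u = neighborhood G v"

definition false_twin_free :: "'a pair_pre_digraph \<Rightarrow> bool" where
  "false_twin_free G \<longleftrightarrow> \<not> (\<exists>u v. false_twins G u v)"

definition bipartite :: "'a pair_pre_digraph \<Rightarrow> bool" where
  "bipartite G \<longleftrightarrow>
     (\<exists>A B. pverts G = A \<union> B \<and> A \<inter> B = {} \<and> parcs G \<subseteq> A \<times> B \<union> B \<times> A)"

definition total_dominating_set :: "'a pair_pre_digraph \<Rightarrow> 'a set \<Rightarrow> bool" where
  "total_dominating_set G S \<longleftrightarrow>
     S \<subseteq> pverts G \<and> (\<forall>v \<in> pverts G. \<exists>u \<in> S. u \<in> neighborhood G v)"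

text \<open>
  The minimum here and the maximum below are taken over finite sets, which are nonempty for finite
  graphs without isolated vertices.
\<close>

definition total_domination_number :: "'a pair_pre_digraph \<Rightarrow> nat" where
  "total_domination_number G = Min {card S | S. total_dominating_set G S}"

text \<open>Positions in a list count from 0, so the first vertex of a sequence is unconstrained.\<close>

definition legal_sequence :: "'a pair_pre_digraph \<Rightarrow> 'a list \<Rightarrow> bool" where
  "legal_sequence G vs \<longleftrightarrow>
     distinct vs \<and> set vs \<subseteq> pverts G \<and>
     (\<forall>i \<in> {1..<length vs}.
        neighborhood G (vs ! i) - (\<Union>j<i. neighborhood G (vs ! j)) \<noteq> {})"

definition total_dominating_sequence :: "'a pair_pre_digraph \<Rightarrow> 'a list \<Rightarrow> bool" where
  "total_dominating_sequence G vs \<longleftrightarrow> legal_sequence G vs \<and> total_dominating_set G (set vs)"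

definition grundy_total_domination_number :: "'a pair_pre_digraph \<Rightarrow> nat" where
  "grundy_total_domination_number G = Max {length vs | vs. total_dominating_sequence G vs}"

definition edges :: "'a pair_pre_digraph \<Rightarrow> 'a set set" where
  "edges G = {{u, v} | u v. (u, v) \<in> parcs G}"

definition perfect_matching :: "'a pair_pre_digraph \<Rightarrow> 'a set set \<Rightarrow> bool" where
  "perfect_matching G M \<longleftrightarrow> M \<subseteq> edges G \<and> (\<forall>v \<in> pverts G. \<exists>!e. e \<in> M \<and> v \<in> e)"

definition delete_edges :: "'a pair_pre_digraph \<Rightarrow> 'a set set \<Rightarrow> 'a pair_pre_digraph" where
  "delete_edges G M =
     \<lparr>pverts = pverts G, parcs = {(u, v). (u, v) \<in> parcs G \<and> {u, v} \<notin> M}\<rparr>"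

end

theory Submission
  imports Defs
begin

text \<open>
  Write \<open>A\<close> and \<open>B\<close> for the two sides of the bipartition. Since a vertex of \<open>A\<close> dominates only
  vertices of \<open>B\<close> and vice versa, legality and domination can be checked on the two sides
  separately. The graphs \<open>K\<^sub>n\<^sub>,\<^sub>n - M\<close>, here called crown graphs, are those in which the
  non-adjacent pairs of \<open>A \<times> B\<close> form the graph of a bijection \<open>f\<close>.

  In a crown graph one vertex of \<open>A\<close> misses exactly one vertex of \<open>B\<close>, while any two of them
  dominate all of \<open>B\<close>. Hence a total dominating set needs two vertices from each side, and a legal
  sequence cannot have three from one side, so that both invariants equal 4.

  Conversely, assume that both invariants equal 4. A longest legal sequence is dominating, because
  a neighbour of an undominated vertex could be appended to it; therefore every legal sequence has
  length at most 4. Two distinct vertices \<open>a, a'\<close> of \<open>A\<close> have different neighbourhoods,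
  so in a suitable order they form a legal sequence. If they did not dominate \<open>B\<close>, a third vertex
  of \<open>A\<close> could be added, and then two vertices of \<open>B\<close>: a legal sequence of length 5
  (\<open>two_neighborhoods_cover\<close>). So each vertex of \<open>B\<close> has at most one non-neighbour in \<open>A\<close>. It also
  has at least one, since a vertex joined to the whole other side would lie in a total
  dominating set with at most three elements (\<open>total_domination_number_le_3\<close>). By symmetry
  the same holds for \<open>A\<close>, and sending each vertex to its only non-neighbour is the required
  bijection.
\<close>

section \<open>Total dominating sets and legal sequences\<close>

lemma neighborhood_sym:
  assumes "pair_graph G" "u \<in> neighborhood G v"
  shows "v \<in> neighborhood G u"
proof -
  interpret pair_graph G by fact
  show ?thesis using assms(2) arcs_symmetric by (simp add: neighborhood_def)
qed

lemma neighborhood_subset_verts: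
  assumes "pair_graph G"
  shows "neighborhood G v \<subseteq> pverts G"
proof -
  interpret pair_graph G by fact
  show ?thesis using in_arcsD2 by (auto simp: neighborhood_def)
qed

lemma finite_pverts: "pair_graph G \<Longrightarrow> finite (pverts G)"
  by (simp add: pair_graph_def pair_digraph_def pair_fin_digraph_def pair_fin_digraph_axioms_def)

lemma total_dominating_set_verts:
  assumes "pair_graph G" "no_isolated_vertices G"
  shows "total_dominating_set G (pverts G)"
  using assms neighborhood_subset_verts[OF assms(1)]
  by (fastforce simp: total_dominating_set_def no_isolated_vertices_def)

lemma finite_total_dominating_set_cards:
  assumes "pair_graph G"
  shows "finite {card S | S. total_dominating_set G S}"
proof -
  have "{card S | S. total_dominating_set G S} \<subseteq> card ` Pow (pverts G)"
    by (auto simp: total_dominating_set_def)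
  then show ?thesis using finite_pverts[OF assms] by (meson finite_Pow_iff finite_surj)
qed

lemma total_domination_number_le:
  assumes "pair_graph G" "total_dominating_set G S"
  shows "total_domination_number G \<le> card S"
  unfolding total_domination_number_def
  using finite_total_dominating_set_cards[OF assms(1)] assms(2) by (intro Min_le) auto

lemma total_domination_number_geI:
  assumes "pair_graph G" "no_isolated_vertices G"
    and "\<And>S. total_dominating_set G S \<Longrightarrow> k \<le> card S"
  shows "k \<le> total_domination_number G"
  unfolding total_domination_number_def
  using finite_total_dominating_set_cards[OF assms(1)] total_dominating_set_verts[OF assms(1,2)]
    assms(3) by (subst Min_ge_iff) auto

lemma legal_sequence_Nil: "legal_sequence G []"
  by (simp add: legal_sequence_def)

text \<open>
  Distinctness of the extended sequence is automatic: a repeated vertex dominates nothing new.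
\<close>

lemma legal_sequence_snoc:
  assumes "legal_sequence G vs" "v \<in> pverts G"
    and "w \<in> neighborhood G v" "\<And>u. u \<in> set vs \<Longrightarrow> w \<notin> neighborhood G u"
  shows "legal_sequence G (vs @ [v])"
proof -
  have "neighborhood G ((vs @ [v]) ! i) - (\<Union>j<i. neighborhood G ((vs @ [v]) ! j)) \<noteq> {}"
    if i: "i \<in> {1..<length (vs @ [v])}" for i
  proof (cases "i < length vs")
    case True
    then have "(\<Union>j<i. neighborhood G ((vs @ [v]) ! j)) = (\<Union>j<i. neighborhood G (vs ! j))"
      by (auto simp: nth_append)
    with True i assms(1) show ?thesis by (simp add: legal_sequence_def nth_append)
  next
    case False
    with i have "i = length vs" by simp
    with assms(3,4) have "w \<in> neighborhood G ((vs @ [v]) ! i)"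
      "w \<notin> (\<Union>j<i. neighborhood G ((vs @ [v]) ! j))"
      by (auto simp: nth_append)
    then show ?thesis by blast
  qed
  moreover have "v \<notin> set vs" using assms(3,4) by blast
  ultimately show ?thesis using assms(1,2) by (auto simp: legal_sequence_def)
qed

lemma legal_sequence_length:
  assumes "pair_graph G" "legal_sequence G vs"
  shows "length vs \<le> card (pverts G)"
  using assms finite_pverts[OF assms(1)]
  by (metis card_mono distinct_card legal_sequence_def)

text \<open>
  A legal sequence of maximal length dominates: otherwise a neighbour of an undominated vertex
  could be appended. This makes the Grundy number an upper bound for the lengths of all legal
  sequences, dominating or not.
\<close>

lemma longest_legal_sequence_dominates:
  assumes "pair_graph G" "no_isolated_vertices G"
    and legal: "legal_sequence G vs"
    and longest: "\<And>us. legal_sequence G us \<Longrightarrow> length us \<le> length vs"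
  shows "total_dominating_sequence G vs"
proof -
  have "\<exists>u\<in>set vs. u \<in> neighborhood G v" if v: "v \<in> pverts G" for v
  proof (rule ccontr)
    assume undominated: "\<not> (\<exists>u\<in>set vs. u \<in> neighborhood G v)"
    obtain u where u: "u \<in> neighborhood G v"
      using v assms(2) by (auto simp: no_isolated_vertices_def)
    have "legal_sequence G (vs @ [u])"
    proof (rule legal_sequence_snoc[OF legal])
      show "u \<in> pverts G" using u neighborhood_subset_verts[OF assms(1)] by blast
      show "v \<in> neighborhood G u" using u by (rule neighborhood_sym[OF assms(1)])
      show "v \<notin> neighborhood G x" if "x \<in> set vs" for x
        using that undominated neighborhood_sym[OF assms(1)] by blast
    qed
    from longest[OF this] show False by simp
  qed
  then show ?thesis
    using legal by (auto simp: total_dominating_sequence_def total_dominating_set_def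
        legal_sequence_def)
qed

lemma ex_longest_legal_sequence:
  assumes "pair_graph G"
  shows "\<exists>vs. legal_sequence G vs \<and> (\<forall>us. legal_sequence G us \<longrightarrow> length us \<le> length vs)"
  using legal_sequence_Nil legal_sequence_length[OF assms]
  by (intro ex_has_greatest_nat[where b = "Suc (card (pverts G))"]) (auto simp: less_Suc_eq_le)

lemma finite_total_dominating_sequence_lengths:
  assumes "pair_graph G"
  shows "finite {length vs | vs. total_dominating_sequence G vs}"
proof (rule finite_subset)
  show "{length vs | vs. total_dominating_sequence G vs} \<subseteq> {..card (pverts G)}"
    using legal_sequence_length[OF assms] by (auto simp: total_dominating_sequence_def)
qed simp

lemma legal_sequence_length_le_grundy:
  assumes "pair_graph G" "no_isolated_vertices G" "legal_sequence G us"
  shows "length us \<le> grundy_total_domination_number G"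
proof -
  obtain vs where vs: "legal_sequence G vs"
    "\<And>us. legal_sequence G us \<Longrightarrow> length us \<le> length vs"
    using ex_longest_legal_sequence[OF assms(1)] by blast
  then have "total_dominating_sequence G vs"
    using longest_legal_sequence_dominates[OF assms(1,2)] by blast
  then have "length vs \<le> grundy_total_domination_number G"
    unfolding grundy_total_domination_number_def
    using finite_total_dominating_sequence_lengths[OF assms(1)] by (intro Max_ge) auto
  with vs(2)[OF assms(3)] show ?thesis by simp
qed

lemma grundy_total_domination_number_leI:
  assumes "pair_graph G" "no_isolated_vertices G"
    and "\<And>vs. legal_sequence G vs \<Longrightarrow> length vs \<le> k"
  shows "grundy_total_domination_number G \<le> k"
proof -
  obtain vs where "legal_sequence G vs"
    "\<And>us. legal_sequence G us \<Longrightarrow> length us \<le> length vs"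
    using ex_longest_legal_sequence[OF assms(1)] by blast
  then have "total_dominating_sequence G vs"
    using longest_legal_sequence_dominates[OF assms(1,2)] by blast
  then show ?thesis
    unfolding grundy_total_domination_number_def
    using finite_total_dominating_sequence_lengths[OF assms(1)] assms(3)
    by (subst Max_le_iff) (auto simp: total_dominating_sequence_def)
qed

lemma total_domination_number_le_grundy:
  assumes "pair_graph G" "no_isolated_vertices G"
  shows "total_domination_number G \<le> grundy_total_domination_number G"
proof -
  obtain vs where vs: "legal_sequence G vs"
    "\<And>us. legal_sequence G us \<Longrightarrow> length us \<le> length vs"
    using ex_longest_legal_sequence[OF assms(1)] by blast
  then have "total_dominating_set G (set vs)"
    using longest_legal_sequence_dominates[OF assms] by (auto simp: total_dominating_sequence_def)
  then have "total_domination_number G \<le> card (set vs)"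
    by (rule total_domination_number_le[OF assms(1)])
  also have "\<dots> = length vs" using vs(1) by (simp add: legal_sequence_def distinct_card)
  also have "\<dots> \<le> grundy_total_domination_number G"
    using vs(1) by (rule legal_sequence_length_le_grundy[OF assms])
  finally show ?thesis .
qed


section \<open>Crown graphs have both numbers equal to 4\<close>

definition bipartition :: "'a pair_pre_digraph \<Rightarrow> 'a set \<Rightarrow> 'a set \<Rightarrow> bool" where
  "bipartition G A B \<longleftrightarrow>
     pverts G = A \<union> B \<and> A \<inter> B = {} \<and> parcs G \<subseteq> A \<times> B \<union> B \<times> A"

definition crown_graph :: "'a pair_pre_digraph \<Rightarrow> 'a set \<Rightarrow> 'a set \<Rightarrow> ('a \<Rightarrow> 'a) \<Rightarrow> bool" where
  "crown_graph G A B f \<longleftrightarrow>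
     pverts G = A \<union> B \<and> A \<inter> B = {} \<and> bij_betw f A B \<and>
     parcs G = {(a, b). a \<in> A \<and> b \<in> B \<and> b \<noteq> f a} \<union> {(b, a). a \<in> A \<and> b \<in> B \<and> b \<noteq> f a}"

lemma bipartition_sym: "bipartition G A B \<Longrightarrow> bipartition G B A"
  by (auto simp: bipartition_def)

lemma bipartition_neighborhood_subset:
  "bipartition G A B \<Longrightarrow> a \<in> A \<Longrightarrow> neighborhood G a \<subseteq> B"
  by (auto simp: bipartition_def neighborhood_def)

lemma crown_graph_sym:
  assumes "crown_graph G A B f"
  shows "crown_graph G B A (inv_into A f)"
proof -
  have bij: "bij_betw f A B" using assms by (simp add: crown_graph_def)
  have "b = f a \<longleftrightarrow> a = inv_into A f b" if "a \<in> A" "b \<in> B" for a b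
    using bij that by (metis bij_betw_inv_into_left bij_betw_inv_into_right)
  then have "{(a, b). a \<in> A \<and> b \<in> B \<and> b \<noteq> f a} = {(a, b). b \<in> B \<and> a \<in> A \<and> a \<noteq> inv_into A f b}"
    "{(b, a). a \<in> A \<and> b \<in> B \<and> b \<noteq> f a} = {(b, a). b \<in> B \<and> a \<in> A \<and> a \<noteq> inv_into A f b}"
    by blast+
  with assms show ?thesis
    using bij_betw_inv_into[OF bij] by (simp add: crown_graph_def Un_commute Int_commute)
qed

lemma crown_graph_neighborhood:
  assumes "crown_graph G A B f" "a \<in> A"
  shows "neighborhood G a = B - {f a}"
  using assms by (auto simp: crown_graph_def neighborhood_def)

text \<open>
  Dominating a vertex of \<open>B\<close> takes some \<open>a \<in> S \<inter> A\<close>, and the non-neighbour \<open>f a\<close> of \<open>a\<close> takes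
  a second one.
\<close>

lemma crown_graph_dominating_side:
  assumes "crown_graph G A B f" "pair_graph G" "A \<noteq> {}" "total_dominating_set G S"
  shows "2 \<le> card (S \<inter> A)"
proof -
  have dom: "\<exists>a \<in> S \<inter> A. b \<noteq> f a" if "b \<in> B" for b
  proof -
    have "b \<in> pverts G" using assms(1) that by (simp add: crown_graph_def)
    then obtain a where "a \<in> S" "(b, a) \<in> parcs G"
      using assms(4) by (auto simp: total_dominating_set_def neighborhood_def)
    then show ?thesis using assms(1) that by (auto simp: crown_graph_def)
  qed
  have f: "f a \<in> B" if "a \<in> A" for a
    using assms(1) that by (auto simp: crown_graph_def bij_betw_def)
  from assms(3) f dom obtain a where a: "a \<in> S \<inter> A" by blast
  with f dom obtain a' where a': "a' \<in> S \<inter> A" "f a \<noteq> f a'" by blast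
  have "finite (S \<inter> A)"
    using finite_pverts[OF assms(2)] assms(1) by (auto simp: crown_graph_def)
  then have "card {a, a'} \<le> card (S \<inter> A)" using a a' by (intro card_mono) auto
  moreover have "a \<noteq> a'" using a' by blast
  ultimately show ?thesis by simp
qed

text \<open>
  Two vertices of \<open>A\<close> already dominate \<open>B\<close>, so the last of three could not be added legally.
\<close>

lemma crown_graph_legal_side:
  assumes "crown_graph G A B f" "legal_sequence G vs"
  shows "card (set vs \<inter> A) \<le> 2"
proof (rule ccontr)
  assume "\<not> card (set vs \<inter> A) \<le> 2"
  define I where "I = {i. i < length vs \<and> vs ! i \<in> A}"
  have "set vs \<inter> A = (!) vs ` I" by (auto simp: I_def in_set_conv_nth)
  moreover have [simp]: "finite I" by (simp add: I_def)
  ultimately have I: "3 \<le> card I"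
    using \<open>\<not> card (set vs \<inter> A) \<le> 2\<close> card_image_le[of I "(!) vs"] by simp
  define k where "k = Max I"
  have "I \<noteq> {}" using I by auto
  then have k: "k \<in> I" by (simp add: k_def)
  have "2 \<le> card (I - {k})" using I k by (simp add: card_Diff_singleton)
  then obtain i j where ij: "i \<in> I - {k}" "j \<in> I - {k}" "i \<noteq> j"
    using card_le_Suc0_iff_eq[of "I - {k}"] by auto
  then have less: "i < k" "j < k"
    using Max_ge[OF \<open>finite I\<close>] by (auto simp: k_def order.strict_iff_order)
  have vs: "distinct vs" "i < length vs" "j < length vs" "k < length vs"
    "vs ! i \<in> A" "vs ! j \<in> A" "vs ! k \<in> A"
    using ij k assms(2) by (auto simp: I_def legal_sequence_def)
  then have "vs ! i \<noteq> vs ! j" using ij(3) by (simp add: nth_eq_iff_index_eq)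
  then have "f (vs ! i) \<noteq> f (vs ! j)"
    using assms(1) vs by (auto simp: crown_graph_def bij_betw_def inj_on_def)
  then have "neighborhood G (vs ! i) \<union> neighborhood G (vs ! j) = B"
    using vs by (auto simp: crown_graph_neighborhood[OF assms(1)])
  moreover have "neighborhood G (vs ! k) \<subseteq> B"
    using vs by (auto simp: crown_graph_neighborhood[OF assms(1)])
  ultimately have "neighborhood G (vs ! k) \<subseteq> (\<Union>j<k. neighborhood G (vs ! j))"
    using less by blast
  moreover have "k \<in> {1..<length vs}" using less vs by auto
  ultimately show False using assms(2) by (auto simp: legal_sequence_def)
qed

lemma crown_graph_numbers:
  assumes pg: "pair_graph G" and iso: "no_isolated_vertices G"
    and crown: "crown_graph G A B f" and card: "2 \<le> card A"
  shows "total_domination_number G = 4 \<and> grundy_total_domination_number G = 4"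
proof -
  note sides = crown crown_graph_sym[OF crown]
  have verts: "pverts G = A \<union> B" and disj: "A \<inter> B = {}"
    using crown by (auto simp: crown_graph_def)
  have fin: "finite A" "finite B" using finite_pverts[OF pg] verts by auto
  have "card B = card A" using crown bij_betw_same_card by (fastforce simp: crown_graph_def)
  then have ne: "A \<noteq> {}" "B \<noteq> {}" using card by auto
  have split: "card S = card (S \<inter> A) + card (S \<inter> B)" if "S \<subseteq> pverts G" for S
  proof -
    have "S = (S \<inter> A) \<union> (S \<inter> B)" using that verts by blast
    then show ?thesis using disj fin card_Un_disjoint[of "S \<inter> A" "S \<inter> B"] by auto
  qed
  have "4 \<le> total_domination_number G"
  proof (rule total_domination_number_geI[OF pg iso])
    fix S assume S: "total_dominating_set G S"
    then have "S \<subseteq> pverts G" by (simp add: total_dominating_set_def)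
    from split[OF this] show "4 \<le> card S"
      using crown_graph_dominating_side[OF sides(1) pg ne(1) S]
        crown_graph_dominating_side[OF sides(2) pg ne(2) S] by simp
  qed
  moreover have "grundy_total_domination_number G \<le> 4"
  proof (rule grundy_total_domination_number_leI[OF pg iso])
    fix vs assume vs: "legal_sequence G vs"
    then have "set vs \<subseteq> pverts G" "length vs = card (set vs)"
      by (auto simp: legal_sequence_def distinct_card)
    with split show "length vs \<le> 4"
      using crown_graph_legal_side[OF sides(1) vs] crown_graph_legal_side[OF sides(2) vs] by simp
  qed
  ultimately show ?thesis using total_domination_number_le_grundy[OF pg iso] by simp
qed


section \<open>Graphs with both numbers equal to 4 are crown graphs\<close>

lemma twin_free_legal_pair:
  assumes "false_twin_free G" "x \<in> pverts G" "y \<in> pverts G" "x \<noteq> y"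
  obtains p q w where "{p, q} = {x, y}" "w \<in> neighborhood G q" "w \<notin> neighborhood G p"
proof -
  have "neighborhood G x \<noteq> neighborhood G y"
    using assms by (auto simp: false_twin_free_def false_twins_def)
  then show thesis using that[of x y] that[of y x] by blast
qed

text \<open>
  Otherwise three vertices of \<open>A\<close> followed by two of \<open>B\<close> would form a legal sequence. There are
  two vertices in \<open>B\<close>, since with only one all vertices of \<open>A\<close> would be twins.
\<close>

lemma two_neighborhoods_cover:
  assumes pg: "pair_graph G" and iso: "no_isolated_vertices G" and tf: "false_twin_free G"
    and bip: "bipartition G A B" and grundy: "grundy_total_domination_number G \<le> 4"
    and a: "a \<in> A" "a' \<in> A" "a \<noteq> a'"
  shows "neighborhood G a \<union> neighborhood G a' = B"
proof (rule ccontr)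
  assume not_cover: "neighborhood G a \<union> neighborhood G a' \<noteq> B"
  have verts: "pverts G = A \<union> B" "A \<inter> B = {}" using bip by (auto simp: bipartition_def)
  note NA = bipartition_neighborhood_subset[OF bip]
  note NB = bipartition_neighborhood_subset[OF bipartition_sym[OF bip]]
  have ne: "neighborhood G v \<noteq> {}" if "v \<in> A \<union> B" for v
    using iso that verts by (simp add: no_isolated_vertices_def)
  obtain b where b: "b \<in> B" "b \<notin> neighborhood G a" "b \<notin> neighborhood G a'"
    using not_cover NA a by blast
  obtain a'' where a'': "a'' \<in> A" "b \<in> neighborhood G a''"
    using ne[of b] NB b(1) neighborhood_sym[OF pg] by blast
  obtain p q w where pq: "{p, q} = {a, a'}" "w \<in> neighborhood G q" "w \<notin> neighborhood G p"
    using twin_free_legal_pair[OF tf, of a a'] a verts by auto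
  then have pqA: "p \<in> A" "q \<in> A" "b \<notin> neighborhood G p" "b \<notin> neighborhood G q"
    using a b by (auto simp: doubleton_eq_iff)
  have "\<exists>b'\<in>B. b' \<noteq> b"
  proof (rule ccontr)
    assume "\<not> (\<exists>b'\<in>B. b' \<noteq> b)"
    then have "B = {b}" using b(1) by blast
    then show False using NA ne a(1) b(2) by blast
  qed
  then obtain b' where "b' \<in> B" "b' \<noteq> b" by blast
  then obtain r s x where rs: "{r, s} = {b, b'}" "x \<in> neighborhood G s" "x \<notin> neighborhood G r"
    using twin_free_legal_pair[OF tf, of b b'] b verts by auto
  then have rsB: "r \<in> B" "s \<in> B" using b \<open>b' \<in> B\<close> by (auto simp: doubleton_eq_iff)
  obtain y z where yz: "y \<in> neighborhood G p" "z \<in> neighborhood G r"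
    using ne pqA(1) rsB(1) by blast
  \<comment> \<open>The vertices of \<open>B\<close> dominate only \<open>A\<close>, which the vertices of \<open>A\<close> leave untouched.\<close>
  have xz: "x \<in> A" "z \<in> A" using NB rsB rs(2) yz(2) by blast+
  have A_free: "v \<notin> neighborhood G u" if "v \<in> A" "u \<in> A" for u v
    using that NA verts by blast
  have "legal_sequence G ([] @ [p])"
    by (rule legal_sequence_snoc[OF legal_sequence_Nil _ yz(1)]) (use pqA verts in auto)
  then have "legal_sequence G ([p] @ [q])"
    by (intro legal_sequence_snoc[OF _ _ pq(2)]) (use pqA pq verts in auto)
  then have "legal_sequence G ([p, q] @ [a''])"
    by (intro legal_sequence_snoc[OF _ _ a''(2)]) (use pqA a'' verts in auto)
  then have "legal_sequence G ([p, q, a''] @ [r])"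
    by (intro legal_sequence_snoc[OF _ _ yz(2)]) (use pqA a'' rsB xz A_free verts in auto)
  then have "legal_sequence G ([p, q, a'', r] @ [s])"
    by (intro legal_sequence_snoc[OF _ _ rs(2)]) (use pqA a'' rsB rs xz A_free verts in auto)
  from legal_sequence_length_le_grundy[OF pg iso this] grundy show False by simp
qed

text \<open>
  The vertex \<open>a\<close> takes care of \<open>B\<close>, and at most two vertices of \<open>B\<close> are needed for \<open>A\<close>.
\<close>

lemma total_domination_number_le_3:
  assumes pg: "pair_graph G" and iso: "no_isolated_vertices G" and bip: "bipartition G A B"
    and cover: "\<And>b b'. b \<in> B \<Longrightarrow> b' \<in> B \<Longrightarrow> b \<noteq> b' \<Longrightarrow> neighborhood G b \<union> neighborhood G b' = A"
    and a: "a \<in> A" "neighborhood G a = B"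
  shows "total_domination_number G \<le> 3"
proof -
  have verts: "pverts G = A \<union> B" using bip by (auto simp: bipartition_def)
  have "B \<noteq> {}" using iso a verts by (auto simp: no_isolated_vertices_def)
  then obtain b where b: "b \<in> B" by blast
  have "\<exists>b'\<in>B. A \<subseteq> neighborhood G b \<union> neighborhood G b'"
  proof (cases "B = {b}")
    case True
    have "b \<in> neighborhood G v" if "v \<in> A" for v
      using iso verts that bipartition_neighborhood_subset[OF bip that] True
      by (auto simp: no_isolated_vertices_def)
    then show ?thesis using b neighborhood_sym[OF pg] by blast
  next
    case False
    then obtain b' where "b' \<in> B" "b \<noteq> b'" using b by blast
    with cover[OF b this] show ?thesis by blast
  qed
  then obtain b' where b': "b' \<in> B" "A \<subseteq> neighborhood G b \<union> neighborhood G b'" by blast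
  have "total_dominating_set G {a, b, b'}"
    unfolding total_dominating_set_def
  proof (intro conjI ballI)
    show "{a, b, b'} \<subseteq> pverts G" using verts a b b' by auto
    fix v assume "v \<in> pverts G"
    then consider "v \<in> A" | "v \<in> B" using verts by blast
    then have "v \<in> neighborhood G a \<or> v \<in> neighborhood G b \<or> v \<in> neighborhood G b'"
      using a b' by cases auto
    then show "\<exists>u\<in>{a, b, b'}. u \<in> neighborhood G v" using neighborhood_sym[OF pg] by blast
  qed
  then have "total_domination_number G \<le> card {a, b, b'}"
    by (rule total_domination_number_le[OF pg])
  also have "\<dots> \<le> 3" using card_insert_le_m1[of 3 "{b, b'}" a] card_insert_le_m1[of 2 "{b'}" b] by simp
  finally show ?thesis .
qed

lemma unique_non_neighbor:
  assumes pg: "pair_graph G" and iso: "no_isolated_vertices G" and tf: "false_twin_free G"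
    and bip: "bipartition G A B"
    and numbers: "total_domination_number G = 4" "grundy_total_domination_number G = 4"
    and a: "a \<in> A"
  shows "\<exists>!b. b \<in> B \<and> b \<notin> neighborhood G a"
proof -
  have cover: "neighborhood G b \<union> neighborhood G b' = A" if "b \<in> B" "b' \<in> B" "b \<noteq> b'" for b b'
    using two_neighborhoods_cover[OF pg iso tf bipartition_sym[OF bip]] numbers that by simp
  have "neighborhood G a \<noteq> B"
    using total_domination_number_le_3[OF pg iso bip cover a] numbers by auto
  then have "\<exists>b. b \<in> B \<and> b \<notin> neighborhood G a"
    using bipartition_neighborhood_subset[OF bip a] by blast
  moreover have "b = b'" if "b \<in> B" "b' \<in> B" "b \<notin> neighborhood G a" "b' \<notin> neighborhood G a" for b b'
    using cover[of b b'] that a neighborhood_sym[OF pg] by blast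
  ultimately show ?thesis by blast
qed

lemma numbers_imp_crown_graph:
  assumes pg: "pair_graph G" and iso: "no_isolated_vertices G" and tf: "false_twin_free G"
    and "bipartite G"
    and numbers: "total_domination_number G = 4" "grundy_total_domination_number G = 4"
  shows "\<exists>A B f. crown_graph G A B f \<and> 2 \<le> card A"
proof -
  obtain A B where bip: "bipartition G A B"
    using \<open>bipartite G\<close> by (auto simp: bipartite_def bipartition_def)
  then have verts: "pverts G = A \<union> B" "A \<inter> B = {}" by (auto simp: bipartition_def)
  have uA: "\<exists>!b. b \<in> B \<and> b \<notin> neighborhood G a" if "a \<in> A" for a
    using unique_non_neighbor[OF pg iso tf bip numbers that] .
  have uB: "\<exists>!a. a \<in> A \<and> b \<notin> neighborhood G a" if "b \<in> B" for b
    using unique_non_neighbor[OF pg iso tf bipartition_sym[OF bip] numbers that]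
      neighborhood_sym[OF pg] by metis
  define f where "f a = (THE b. b \<in> B \<and> b \<notin> neighborhood G a)" for a
  have f: "f a \<in> B" "f a \<notin> neighborhood G a" if "a \<in> A" for a
    using theI'[OF uA[OF that]] by (auto simp: f_def)
  have f_eq: "b = f a" if "a \<in> A" "b \<in> B" "b \<notin> neighborhood G a" for a b
    using uA[OF that(1)] f[OF that(1)] that(2,3) by blast
  have nbr: "b \<in> neighborhood G a \<longleftrightarrow> b \<noteq> f a" if "a \<in> A" "b \<in> B" for a b
    using f f_eq that by blast
  have "bij_betw f A B"
  proof (rule bij_betw_imageI)
    show "inj_on f A"
    proof (rule inj_onI)
      fix a a' assume "a \<in> A" "a' \<in> A" "f a = f a'"
      then show "a = a'" using uB[of "f a"] f[of a] f[of a'] by auto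
    qed
    show "f ` A = B" using f(1) f_eq uB by blast
  qed
  moreover have
    "parcs G = {(a, b). a \<in> A \<and> b \<in> B \<and> b \<noteq> f a} \<union> {(b, a). a \<in> A \<and> b \<in> B \<and> b \<noteq> f a}"
  proof -
    have arcs: "(v, u) \<in> parcs G \<longleftrightarrow> u \<in> neighborhood G v" for u v
      by (simp add: neighborhood_def)
    have "(x, y) \<in> parcs G \<longleftrightarrow>
        x \<in> A \<and> y \<in> B \<and> y \<in> neighborhood G x \<or> y \<in> A \<and> x \<in> B \<and> x \<in> neighborhood G y" for x y
      using bip neighborhood_sym[OF pg] arcs[of x y] by (auto simp: bipartition_def)
    then show ?thesis using nbr by auto
  qed
  ultimately have crown: "crown_graph G A B f" using verts by (simp add: crown_graph_def)
  have "A \<noteq> {}"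
  proof
    assume "A = {}"
    \<comment> \<open>Every vertex of \<open>B\<close> has its non-neighbour in \<open>A\<close>, so \<open>B\<close> would be empty as well.\<close>
    then have "B = {}" using uB by blast
    with \<open>A = {}\<close> have "total_dominating_set G {}" using verts by (simp add: total_dominating_set_def)
    then show False using total_domination_number_le[OF pg, of "{}"] numbers by simp
  qed
  then obtain a where a: "a \<in> A" by blast
  have "neighborhood G (f a) \<noteq> {}" using iso f(1)[OF a] verts by (simp add: no_isolated_vertices_def)
  then obtain a' where a': "a' \<in> neighborhood G (f a)" by blast
  have "a' \<in> A" using a' bipartition_neighborhood_subset[OF bipartition_sym[OF bip]] f(1)[OF a] by blast
  moreover have "a' \<noteq> a" using a' f(2)[OF a] neighborhood_sym[OF pg] by blast
  moreover have "finite A" using finite_pverts[OF pg] verts by simp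
  ultimately have "2 \<le> card A" using a card_mono[of A "{a, a'}"] by simp
  then show ?thesis using crown by blast
qed


section \<open>Crown graphs as complete bipartite graphs without a perfect matching\<close>

lemma delete_perfect_matching_crown_graph:
  assumes "K\<^bsub>n,n\<^esub> (with_proj K)" and pm: "perfect_matching K M"
  shows "\<exists>U V f. crown_graph (delete_edges K M) U V f \<and> card U = n"
proof -
  obtain U V where K: "pverts K = U \<union> V" "U \<inter> V = {}" "card U = n" "parcs K = U \<times> V \<union> V \<times> U"
    using assms(1) by (auto simp: complete_bipartite_digraph_pair_def)
  have ends: "\<exists>u\<in>U. \<exists>v\<in>V. e = {u, v}" if "e \<in> M" for e
    using pm that K(4) by (fastforce simp: perfect_matching_def edges_def insert_commute)
  have ex: "\<exists>e\<in>M. x \<in> e" and un: "\<And>e e'. e \<in> M \<Longrightarrow> e' \<in> M \<Longrightarrow> x \<in> e \<Longrightarrow> x \<in> e' \<Longrightarrow> e = e'"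
    if "x \<in> U \<union> V" for x
    using pm that K(1) unfolding perfect_matching_def by blast+
  have partner: "\<exists>v\<in>V. {u, v} \<in> M" if u: "u \<in> U" for u
  proof -
    obtain e where e: "e \<in> M" "u \<in> e" using ex u by blast
    with ends obtain u' v where "u' \<in> U" "v \<in> V" "e = {u', v}" by blast
    with e u K(2) show ?thesis by auto
  qed
  have partner': "\<exists>u\<in>U. {u, v} \<in> M" if v: "v \<in> V" for v
  proof -
    obtain e where e: "e \<in> M" "v \<in> e" using ex v by blast
    with ends obtain u v' where "u \<in> U" "v' \<in> V" "e = {u, v'}" by blast
    with e v K(2) show ?thesis by auto
  qed
  define f where "f u = (SOME v. v \<in> V \<and> {u, v} \<in> M)" for u
  have f: "f u \<in> V" "{u, f u} \<in> M" if "u \<in> U" for u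
    using someI_ex[of "\<lambda>v. v \<in> V \<and> {u, v} \<in> M"] partner[OF that] by (auto simp: f_def)
  have M_iff: "{u, v} \<in> M \<longleftrightarrow> v = f u" if "u \<in> U" "v \<in> V" for u v
  proof
    assume "{u, v} \<in> M"
    then have "{u, v} = {u, f u}" using un[of u] f[OF that(1)] that by blast
    then show "v = f u" by (auto simp: doubleton_eq_iff)
  qed (use f that in auto)
  have "bij_betw f U V"
  proof (rule bij_betw_imageI)
    show "inj_on f U"
    proof (rule inj_onI)
      fix u u' assume u: "u \<in> U" "u' \<in> U" "f u = f u'"
      then have "{u, f u} = {u', f u}" using un[of "f u"] f[of u] f[of u'] by auto
      then show "u = u'" by (auto simp: doubleton_eq_iff)
    qed
    show "f ` U = V" using f(1) partner' M_iff by blast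
  qed
  moreover have "parcs (delete_edges K M) =
      {(u, v). u \<in> U \<and> v \<in> V \<and> v \<noteq> f u} \<union> {(v, u). u \<in> U \<and> v \<in> V \<and> v \<noteq> f u}"
  proof -
    have "{v, u} \<in> M \<longleftrightarrow> v = f u" if "u \<in> U" "v \<in> V" for u v
      using M_iff[OF that] by (simp add: insert_commute)
    then show ?thesis using M_iff K(4) by (auto simp: delete_edges_def)
  qed
  ultimately have "crown_graph (delete_edges K M) U V f"
    using K by (simp add: crown_graph_def delete_edges_def)
  then show ?thesis using K(3) by blast
qed

text \<open>Transport along the inverse of the vertex bijection \<open>h\<close> of an isomorphism.\<close>

lemma crown_graph_iso:
  assumes iso: "digraph_iso (with_proj G) (with_proj H)" and crown: "crown_graph H U V f"
  shows "\<exists>A B g. crown_graph G A B g \<and> card A = card U"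
proof -
  obtain F where F: "pre_digraph.digraph_isomorphism (with_proj G) F"
    and H: "with_proj H = app_iso F (with_proj G)"
    using iso by (auto simp: digraph_iso_def)
  define h where "h = iso_verts F"
  interpret G: wf_digraph "with_proj G"
    using F by (simp add: pre_digraph.digraph_isomorphism_def)
  have inj: "inj_on h (pverts G)"
    using G.digraph_isomorphism_inj_on_verts[OF F] by (simp add: h_def)
  have hv: "pverts H = h ` pverts G"
    using arg_cong[OF H, of verts] by (simp add: h_def)
  have "parcs H = (\<lambda>(u, v). (h u, h v)) ` parcs G"
    using G.arcs_ends_app_iso_eq[OF F] arg_cong[OF H, of arcs_ends] by (simp add: h_def)
  moreover have sub: "parcs G \<subseteq> pverts G \<times> pverts G"
    using G.wellformed by auto
  ultimately have arcs: "(u, v) \<in> parcs G \<longleftrightarrow> (h u, h v) \<in> parcs H"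
    if "u \<in> pverts G" "v \<in> pverts G" for u v
    using that by (auto dest: inj_onD[OF inj])
  have UV: "U \<union> V = h ` pverts G" "U \<inter> V = {}" and bf: "bij_betw f U V"
    and parcs_H: "parcs H = {(u, v). u \<in> U \<and> v \<in> V \<and> v \<noteq> f u} \<union> {(v, u). u \<in> U \<and> v \<in> V \<and> v \<noteq> f u}"
    using crown hv by (auto simp: crown_graph_def)
  define A where "A = {x \<in> pverts G. h x \<in> U}"
  define B where "B = {x \<in> pverts G. h x \<in> V}"
  have hA: "bij_betw h A U" and hB: "bij_betw h B V"
    using inj UV by (auto simp: A_def B_def bij_betw_def inj_on_def)
  define g where "g = inv_into B h \<circ> (f \<circ> h)"
  have g: "bij_betw g A B"
    unfolding g_def using hA hB bf by (intro bij_betw_trans[OF bij_betw_trans] bij_betw_inv_into)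
  have hg: "h (g a) = f (h a)" if "a \<in> A" for a
    using that hA hB bf by (auto simp: g_def bij_betw_def intro!: f_inv_into_f)
  have g_iff: "b = g a \<longleftrightarrow> h b = f (h a)" if "a \<in> A" "b \<in> B" for a b
    using that hg[of a] g hB by (metis bij_betw_apply bij_betw_imp_inj_on inj_onD)
  have "pverts G = A \<union> B" using UV by (auto simp: A_def B_def)
  moreover have "A \<inter> B = {}" using UV(2) by (auto simp: A_def B_def)
  moreover have
    "parcs G = {(a, b). a \<in> A \<and> b \<in> B \<and> b \<noteq> g a} \<union> {(b, a). a \<in> A \<and> b \<in> B \<and> b \<noteq> g a}"
      (is "_ = ?R")
  proof -
    have "(x, y) \<in> parcs G \<longleftrightarrow> (x, y) \<in> ?R" if "x \<in> pverts G" "y \<in> pverts G" for x y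
    proof -
      have "(x, y) \<in> parcs G \<longleftrightarrow>
          x \<in> A \<and> y \<in> B \<and> h y \<noteq> f (h x) \<or> y \<in> A \<and> x \<in> B \<and> h x \<noteq> f (h y)"
        using that arcs by (auto simp: parcs_H A_def B_def)
      then show ?thesis using g_iff by auto
    qed
    moreover have "?R \<subseteq> pverts G \<times> pverts G" by (auto simp: A_def B_def)
    ultimately show ?thesis using sub by (intro equalityI subrelI) blast+
  qed
  ultimately have "crown_graph G A B g" using g by (simp add: crown_graph_def)
  moreover have "card A = card U" using hA by (rule bij_betw_same_card)
  ultimately show ?thesis by blast
qed

text \<open>
  Any injection of the finite vertex set into the natural numbers may serve as the isomorphism:
  \<open>K\<close> is then the complete bipartite graph between the images of \<open>A\<close> and \<open>B\<close>.
\<close>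

lemma crown_graph_imp_iso:
  assumes pg: "pair_graph G" and crown: "crown_graph G A B f"
  shows "\<exists>(K :: nat pair_pre_digraph) M. K\<^bsub>card A,card A\<^esub> (with_proj K) \<and> perfect_matching K M \<and>
    digraph_iso (with_proj G) (with_proj (delete_edges K M))"
proof -
  interpret pair_graph G by fact
  have verts: "pverts G = A \<union> B" "A \<inter> B = {}" and f: "bij_betw f A B"
    and parcs_G: "parcs G = {(a, b). a \<in> A \<and> b \<in> B \<and> b \<noteq> f a} \<union> {(b, a). a \<in> A \<and> b \<in> B \<and> b \<noteq> f a}"
    using crown by (auto simp: crown_graph_def)
  have fB: "f a \<in> B" if "a \<in> A" for a using f that by (auto simp: bij_betw_def)
  obtain h :: "'a \<Rightarrow> nat" where inj: "inj_on h (A \<union> B)"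
    using finite_imp_inj_to_nat_seg[OF finite_pverts[OF pg]] verts(1) by metis
  have h_eq: "h x = h y \<longleftrightarrow> x = y" if "x \<in> A \<union> B" "y \<in> A \<union> B" for x y
    using inj that by (auto dest: inj_onD)
  have disj: "h ` A \<inter> h ` B = {}" using inj_on_image_Int[OF inj, of A B] verts(2) by simp
  define K :: "nat pair_pre_digraph" where
    "K = \<lparr>pverts = h ` (A \<union> B), parcs = h ` A \<times> h ` B \<union> h ` B \<times> h ` A\<rparr>"
  define M where "M = (\<lambda>a. {h a, h (f a)}) ` A"
  have "K\<^bsub>card A,card A\<^esub> (with_proj K)"
  proof -
    have "card (h ` A) = card A" "card (h ` B) = card A"
      using inj bij_betw_same_card[OF f] by (auto simp: card_image inj_on_Un)
    moreover have "finite (h ` (A \<union> B))" using finite_pverts[OF pg] verts by simp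
    ultimately show ?thesis
      unfolding complete_bipartite_digraph_pair_def K_def using disj
      by (intro conjI exI[of _ "h ` A"] exI[of _ "h ` B"]) (simp_all add: image_Un)
  qed
  moreover have "perfect_matching K M"
    unfolding perfect_matching_def
  proof (intro conjI ballI)
    show "M \<subseteq> edges K"
    proof
      fix e assume "e \<in> M"
      then obtain a where "a \<in> A" "e = {h a, h (f a)}" by (auto simp: M_def)
      moreover from this have "(h a, h (f a)) \<in> parcs K" using fB by (simp add: K_def)
      ultimately show "e \<in> edges K" by (auto simp: edges_def)
    qed
    fix v assume "v \<in> pverts K"
    then obtain x where x: "x \<in> A \<union> B" "v = h x" by (auto simp: K_def)
    obtain a where a: "a \<in> A" "x = a \<or> x = f a"
      using x(1) f by (auto simp: bij_betw_def)
    have unique: "a' = a" if a': "a' \<in> A" "v \<in> {h a', h (f a')}" for a'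
    proof -
      have "x = a' \<or> x = f a'" using a' x h_eq fB[OF a'(1)] by auto
      then have "a' = a \<or> f a' = f a"
        using a a'(1) fB[OF a(1)] fB[OF a'(1)] verts(2) by blast
      then show ?thesis using inj_onD[OF bij_betw_imp_inj_on[OF f] _ a'(1) a(1)] by blast
    qed
    show "\<exists>!e. e \<in> M \<and> v \<in> e"
    proof (rule ex1I)
      show "{h a, h (f a)} \<in> M \<and> v \<in> {h a, h (f a)}" using a x(2) by (auto simp: M_def)
      fix e assume e: "e \<in> M \<and> v \<in> e"
      then obtain a' where "a' \<in> A" "e = {h a', h (f a')}" by (auto simp: M_def)
      with e unique show "e = {h a, h (f a)}" by blast
    qed
  qed
  moreover have "digraph_iso (with_proj G) (with_proj (delete_edges K M))"
  proof -
    define F where "F = \<lparr>iso_verts = h, iso_arcs = map_prod h h, iso_head = snd, iso_tail = fst\<rparr>"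
    have "inj_on (map_prod h h) (parcs G)"
      by (rule inj_on_subset[OF map_prod_inj_on[OF inj inj]]) (auto simp: parcs_G)
    then have "digraph_isomorphism F"
      using inj verts(1) wf_digraph by (auto simp: digraph_isomorphism_def F_def)
    moreover have "with_proj (delete_edges K M) = app_iso F (with_proj G)"
    proof -
      have M_iff: "{h a, h b} \<in> M \<longleftrightarrow> b = f a" if ab: "a \<in> A" "b \<in> B" for a b
      proof
        assume "{h a, h b} \<in> M"
        then obtain a' where a': "a' \<in> A" "{h a, h b} = {h a', h (f a')}" by (auto simp: M_def)
        then have "h a = h a' \<and> h b = h (f a')"
          using disj ab fB[of a'] by (auto simp: doubleton_eq_iff)
        then show "b = f a" using h_eq[of a a'] h_eq[of b "f a'"] a' ab fB[of a'] by simp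
      qed (use ab in \<open>auto simp: M_def\<close>)
      then have M_iff': "{h b, h a} \<in> M \<longleftrightarrow> b = f a" if "a \<in> A" "b \<in> B" for a b
        using that by (simp add: insert_commute)
      have "parcs (delete_edges K M) = map_prod h h ` parcs G"
      proof (intro equalityI subrelI)
        fix x y assume "(x, y) \<in> parcs (delete_edges K M)"
        then have xy: "(x, y) \<in> h ` A \<times> h ` B \<union> h ` B \<times> h ` A" "{x, y} \<notin> M"
          by (auto simp: delete_edges_def K_def)
        then consider a b where "a \<in> A" "b \<in> B" "x = h a" "y = h b"
          | a b where "a \<in> A" "b \<in> B" "x = h b" "y = h a" by blast
        then show "(x, y) \<in> map_prod h h ` parcs G"
        proof cases
          case (1 a b)
          then have "b \<noteq> f a" using M_iff[of a b] xy(2) by simp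
          with 1 have "(a, b) \<in> parcs G" by (simp add: parcs_G)
          then show ?thesis using 1(3,4) by force
        next
          case (2 a b)
          then have "b \<noteq> f a" using M_iff'[of a b] xy(2) by simp
          with 2 have "(b, a) \<in> parcs G" by (simp add: parcs_G)
          then show ?thesis using 2(3,4) by force
        qed
      next
        fix x y assume "(x, y) \<in> map_prod h h ` parcs G"
        then consider a b where "a \<in> A" "b \<in> B" "b \<noteq> f a" "x = h a" "y = h b"
          | a b where "a \<in> A" "b \<in> B" "b \<noteq> f a" "x = h b" "y = h a"
          by (auto simp: parcs_G)
        then show "(x, y) \<in> parcs (delete_edges K M)"
          by cases (simp_all add: delete_edges_def K_def M_iff M_iff')
      qed
      then show ?thesis
        using verts(1) by (simp add: app_iso_def with_proj_def F_def delete_edges_def K_def)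
    qed
    ultimately show ?thesis by (auto simp: digraph_iso_def)
  qed
  ultimately show ?thesis by blast
qed

theorem theorem3p1:
  fixes G :: "'a pair_pre_digraph"
  assumes "pair_graph G"
    and "bipartite G"
    and "no_isolated_vertices G"
    and "false_twin_free G"
  shows "(total_domination_number G = 4 \<and> grundy_total_domination_number G = 4) \<longleftrightarrow>
    (\<exists>n\<ge>2. \<exists>(K :: nat pair_pre_digraph) M.
       K\<^bsub>n,n\<^esub> (with_proj K) \<and> perfect_matching K M \<and>
       digraph_iso (with_proj G) (with_proj (delete_edges K M)))"
proof
  assume "total_domination_number G = 4 \<and> grundy_total_domination_number G = 4"
  then obtain A B f where "crown_graph G A B f" "2 \<le> card A"
    using numbers_imp_crown_graph[OF assms(1,3,4,2)] by blast
  then show "\<exists>n\<ge>2. \<exists>(K :: nat pair_pre_digraph) M.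
       K\<^bsub>n,n\<^esub> (with_proj K) \<and> perfect_matching K M \<and>
       digraph_iso (with_proj G) (with_proj (delete_edges K M))"
    using crown_graph_imp_iso[OF assms(1)] by blast
next
  assume "\<exists>n\<ge>2. \<exists>(K :: nat pair_pre_digraph) M.
       K\<^bsub>n,n\<^esub> (with_proj K) \<and> perfect_matching K M \<and>
       digraph_iso (with_proj G) (with_proj (delete_edges K M))"
  then obtain n and K :: "nat pair_pre_digraph" and M where n: "2 \<le> n"
    and K: "K\<^bsub>n,n\<^esub> (with_proj K)" "perfect_matching K M"
    and iso: "digraph_iso (with_proj G) (with_proj (delete_edges K M))"
    by blast
  obtain U V f where "crown_graph (delete_edges K M) U V f" "card U = n"
    using delete_perfect_matching_crown_graph[OF K] by blast
  with crown_graph_iso[OF iso] obtain A B g where "crown_graph G A B g" "card A = n" by blast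
  with n show "total_domination_number G = 4 \<and> grundy_total_domination_number G = 4"
    using crown_graph_numbers[OF assms(1,3)] by blast
qed

end
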